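(* For every formula $G$ there exists a unique compact saturated database for $G$, and it is the minimum saturated database for $G$, i.e. it is contained in every saturated database for $G$.
   Context: Formulas are built from a countably infinite set $\mathcal{V}$ of propositional variables and $\bot$ using $\land,\lor,\supset$. Let $\mathcal{V}_\bot=\mathcal{V}\cup\{\bot\}$, $\mathcal{L}^{\supset}$ the set of formulas with main connective $\supset$. For a formula $G$, $\mathrm{Sl}(G)$ and $\mathrm{Sr}(G)$ are the smallest subsets of the subformulas of $G$ with: $G\in\mathrm{Sr}(G)$; $A\land B$ or $A\lor B$ in $\mathrm{Sl}(G)$ (resp. $\mathrm{Sr}(G)$) implies $A,B$ in $\mathrm{Sl}(G)$ (resp. $\mathrm{Sr}(G)$); $A\supset B\in\mathrm{Sl}(G)$ implies $B\in\mathrm{Sl}(G)$, $A\in\mathrm{Sr}(G)$; $A\supset B\in\mathrm{Sr}(G)$ implies $B\in\mathrm{Sr}(G)$, $A\in\mathrm{Sl}(G)$. $\mathrm{Cl}(\Gamma)$ is the smallest set containing $\Gamma$ such that if $X,Y\in\mathrm{Cl}(\Gamma)$ and $A$ is any formula then $X\land Y,A\lor X,X\lor A,A\supset X\in\mathrm{Cl}(\Gamma)$. $\mathbf{FRJ}(G)$: let $\bar\Gamma^{At}=\mathrm{Sl}(G)\cap\mathcal V$, $\bar\Gamma^{\supset}=\mathrm{Sl}(G)\cap\mathcal L^{\supset}$, $\bar\Gamma=\bar\Gamma^{At}\cup\bar\Gamma^{\supset}$. Sequents: regular $\Gamma\Rightarrow C$ ($\Gamma\subseteq\bar\Gamma$,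 $C\in\mathrm{Sr}(G)$), irregular $\Sigma;\Theta\rightarrow C$ ($\Sigma\cup\Theta\subseteq\bar\Gamma$, $C\in\mathrm{Sr}(G)$); conclusions always have right formula in $\mathrm{Sr}(G)$. Rules ($F\in\mathcal V_\bot$, $k\in\{1,2\}$): axioms $\bar\Gamma^{At}\setminus\{F\}\Rightarrow F$ and $\emptyset;(\bar\Gamma^{At}\setminus\{F\})\cup\bar\Gamma^{\supset}\rightarrow F$; ($\land$) $\Gamma\Rightarrow A_k/\Gamma\Rightarrow A_1\land A_2$ and $\Sigma;\Theta\rightarrow A_k/\Sigma;\Theta\rightarrow A_1\land A_2$; ($\lor$) $\Sigma_1;\Theta_1\rightarrow C_1$, $\Sigma_2;\Theta_2\rightarrow C_2 / \Sigma_1\cup\Sigma_2;\Theta_1\cap\Theta_2\rightarrow C_1\lor C_2$ if $\Sigma_1\subseteq\Sigma_2\cup\Theta_2$, $\Sigma_2\subseteq\Sigma_1\cup\Theta_1$; ($\supset_\in$) $\Gamma\Rightarrow B/\Gamma\Rightarrow A\supset B$ if $A\in\mathrm{Cl}(\Gamma)$, and $\Sigma;\Theta\cup\Lambda\rightarrow B/\Sigma\cup\Lambda;\Theta\rightarrow A\supset B$ if $\Theta\cap\Lambda=\emptyset$, $A\in\mathrm{Cl}(\Sigma\cup\Lambda)$ and no $\Lambda'\subsetneq\Lambda$ has $A\in\mathrm{Cl}(\Sigma\cup\Lambda')$; ($\supset_{\notin}$) $\Gamma\Rightarrow B/\emptyset;\Theta\rightarrow A\supset B$ if $\Theta\subseteq\mathrm{Cl}(\Gamma)\cap\bar\Gamma$,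 $A\in\mathrm{Cl}(\Gamma)\setminus\mathrm{Cl}(\Theta)$ and every $\Theta'$ with $\Theta\subsetneq\Theta'\subseteq\mathrm{Cl}(\Gamma)\cap\bar\Gamma$ has $A\in\mathrm{Cl}(\Theta')$; join rules with premises $\Sigma_j;\Theta_j\rightarrow A_j$ ($1\le j\le n$, $n\ge1$): let $\Upsilon=\{A_1,\dots,A_n\}$, $\Sigma^{At}=\bigcup_j(\Sigma_j\cap\mathcal V)$, $\Sigma^{\supset}=\bigcup_j(\Sigma_j\cap\mathcal L^{\supset})$, $\Theta^{At}=\bigcap_j(\Theta_j\cap\mathcal V)$, $\Theta^{\supset}=\{Y\supset Z\in\bigcap_j(\Theta_j\cap\mathcal L^{\supset}):Y\in\Upsilon\}$, requiring $\Sigma_i\subseteq\Sigma_j\cup\Theta_j$ ($i\ne j$) and ($Y\supset Z\in\Sigma^{\supset}\Rightarrow Y\in\Upsilon$); ($\bowtie^{At}$) conclusion $\Sigma^{At}\cup(\Theta^{At}\setminus\{F\})\cup\Sigma^{\supset}\cup\Theta^{\supset}\Rightarrow F$, $F\in\mathcal V_\bot\setminus\Sigma^{At}$, where each $Y\in\Upsilon$ has some $Y\supset Z\in\mathrm{Sl}(G)$; ($\bowtie^{\lor}$) conclusion $\Sigma^{At}\cup\Theta^{At}\cup\Sigma^{\supset}\cup\Theta^{\supset}\Rightarrow C_1\lor C_2$, $\{C_1,C_2\}\subseteq\Upsilon$, where each $Y\in\Upsilon$ has some $Y\supset Z\in\mathrm{Sl}(G)$ or $Y\lor Z\in\mathrm{Sr}(G)$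 or $Z\lor Y\in\mathrm{Sr}(G)$. Subsumption: $\sigma_1\sqsubseteq\sigma_2$ iff either $\sigma_1=\Gamma_1\Rightarrow C$, $\sigma_2=\Gamma_2\Rightarrow C$ with $\Gamma_1\subseteq\Gamma_2$, or $\sigma_1=\Sigma;\Theta_1\rightarrow C$, $\sigma_2=\Sigma;\Theta_2\rightarrow C$ with $\Theta_1\subseteq\Theta_2$; $\sigma_1\sqsubset\sigma_2$ means $\sigma_1\sqsubseteq\sigma_2$ and $\sigma_1\ne\sigma_2$. A database for $G$ is a set of $\mathbf{FRJ}(G)$-sequents each derivable in $\mathbf{FRJ}(G)$; it is saturated if for every derivable $\mathbf{FRJ}(G)$-sequent $\sigma$ it contains some $\sigma'$ with $\sigma\sqsubseteq\sigma'$; it is compact if there are no $\sigma,\sigma'$ in it with $\sigma'\sqsubset\sigma$. *)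

theory Defs
  imports Main
begin

datatype form =
    Var nat
  | Bot
  | And form form  (infixr "\<^bold>\<and>" 65)
  | Or form form   (infixr "\<^bold>\<or>" 60)
  | Imp form form  (infixr "\<^bold>\<supset>" 55)

definition Vars :: "form set" where
  "Vars = range Var"

definition VarsBot :: "form set" where
  "VarsBot = Vars \<union> {Bot}"

definition Imps :: "form set" where
  "Imps = {A \<^bold>\<supset> B | A B. True}"

text \<open>Left and right subformulas. Only the root \<open>G\<close> and immediate subformulas of
  earlier members are ever added, so both sets consist of subformulas of \<open>G\<close>.\<close>

inductive_set Sl :: "form \<Rightarrow> form set" and Sr :: "form \<Rightarrow> form set" for G :: form where
  Sr_root: "G \<in> Sr G"
| Sl_And1: "A \<^bold>\<and> B \<in> Sl G \<Longrightarrow> A \<in> Sl G"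
| Sl_And2: "A \<^bold>\<and> B \<in> Sl G \<Longrightarrow> B \<in> Sl G"
| Sl_Or1: "A \<^bold>\<or> B \<in> Sl G \<Longrightarrow> A \<in> Sl G"
| Sl_Or2: "A \<^bold>\<or> B \<in> Sl G \<Longrightarrow> B \<in> Sl G"
| Sr_And1: "A \<^bold>\<and> B \<in> Sr G \<Longrightarrow> A \<in> Sr G"
| Sr_And2: "A \<^bold>\<and> B \<in> Sr G \<Longrightarrow> B \<in> Sr G"
| Sr_Or1: "A \<^bold>\<or> B \<in> Sr G \<Longrightarrow> A \<in> Sr G"
| Sr_Or2: "A \<^bold>\<or> B \<in> Sr G \<Longrightarrow> B \<in> Sr G"
| Sl_Imp: "A \<^bold>\<supset> B \<in> Sl G \<Longrightarrow> B \<in> Sl G"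
| Sr_Imp_ante: "A \<^bold>\<supset> B \<in> Sl G \<Longrightarrow> A \<in> Sr G"
| Sr_Imp: "A \<^bold>\<supset> B \<in> Sr G \<Longrightarrow> B \<in> Sr G"
| Sl_Imp_ante: "A \<^bold>\<supset> B \<in> Sr G \<Longrightarrow> A \<in> Sl G"

inductive_set Cl :: "form set \<Rightarrow> form set" for \<Gamma> :: "form set" where
  Cl_base: "X \<in> \<Gamma> \<Longrightarrow> X \<in> Cl \<Gamma>"
| Cl_And: "X \<in> Cl \<Gamma> \<Longrightarrow> Y \<in> Cl \<Gamma> \<Longrightarrow> X \<^bold>\<and> Y \<in> Cl \<Gamma>"
| Cl_Or1: "X \<in> Cl \<Gamma> \<Longrightarrow> A \<^bold>\<or> X \<in> Cl \<Gamma>"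
| Cl_Or2: "X \<in> Cl \<Gamma> \<Longrightarrow> X \<^bold>\<or> A \<in> Cl \<Gamma>"
| Cl_Imp: "X \<in> Cl \<Gamma> \<Longrightarrow> A \<^bold>\<supset> X \<in> Cl \<Gamma>"

definition GAt :: "form \<Rightarrow> form set" where
  "GAt G = Sl G \<inter> Vars"

definition GImp :: "form \<Rightarrow> form set" where
  "GImp G = Sl G \<inter> Imps"

definition Gbar :: "form \<Rightarrow> form set" where
  "Gbar G = GAt G \<union> GImp G"

datatype sequent =
    Reg "form set" form             (\<open>_ \<Rightarrow>\<^sub>r _\<close> [51, 51] 50)
  | Irr "form set" "form set" form  (\<open>_ \<^bold>; _ \<rightarrow>\<^sub>i _\<close> [51, 51, 51] 50)

fun FRJ_sequent :: "form \<Rightarrow> sequent \<Rightarrow> bool" where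
  "FRJ_sequent G (\<Gamma> \<Rightarrow>\<^sub>r C) \<longleftrightarrow> \<Gamma> \<subseteq> Gbar G \<and> C \<in> Sr G"
| "FRJ_sequent G (\<Sigma> \<^bold>; \<Theta> \<rightarrow>\<^sub>i C) \<longleftrightarrow> \<Sigma> \<union> \<Theta> \<subseteq> Gbar G \<and> C \<in> Sr G"

text \<open>The premises of a join rule are the irregular sequents
  \<open>S j \<^bold>; T j \<rightarrow>\<^sub>i A j\<close> for \<open>1 \<le> j \<le> n\<close>; values of the families outside
  this range are irrelevant.\<close>

definition Upsilon :: "nat \<Rightarrow> (nat \<Rightarrow> form) \<Rightarrow> form set" where
  "Upsilon n A = A ` {1..n}"

definition SigmaAt :: "nat \<Rightarrow> (nat \<Rightarrow> form set) \<Rightarrow> form set" where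
  "SigmaAt n S = (\<Union>j\<in>{1..n}. S j \<inter> Vars)"

definition SigmaImp :: "nat \<Rightarrow> (nat \<Rightarrow> form set) \<Rightarrow> form set" where
  "SigmaImp n S = (\<Union>j\<in>{1..n}. S j \<inter> Imps)"

definition ThetaAt :: "nat \<Rightarrow> (nat \<Rightarrow> form set) \<Rightarrow> form set" where
  "ThetaAt n T = (\<Inter>j\<in>{1..n}. T j \<inter> Vars)"

definition ThetaImp :: "nat \<Rightarrow> (nat \<Rightarrow> form set) \<Rightarrow> (nat \<Rightarrow> form) \<Rightarrow> form set" where
  "ThetaImp n T A =
     {Y \<^bold>\<supset> Z | Y Z. Y \<^bold>\<supset> Z \<in> (\<Inter>j\<in>{1..n}. T j \<inter> Imps) \<and> Y \<in> Upsilon n A}"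

definition join_cond ::
  "nat \<Rightarrow> (nat \<Rightarrow> form set) \<Rightarrow> (nat \<Rightarrow> form set) \<Rightarrow> (nat \<Rightarrow> form) \<Rightarrow> bool" where
  "join_cond n S T A \<longleftrightarrow>
     (\<forall>i\<in>{1..n}. \<forall>j\<in>{1..n}. i \<noteq> j \<longrightarrow> S i \<subseteq> S j \<union> T j) \<and>
     (\<forall>Y Z. Y \<^bold>\<supset> Z \<in> SigmaImp n S \<longrightarrow> Y \<in> Upsilon n A)"

inductive derivable :: "form \<Rightarrow> sequent \<Rightarrow> bool" for G :: form where
  Ax_reg:
    "\<lbrakk>F \<in> VarsBot; F \<in> Sr G\<rbrakk> \<Longrightarrow> derivable G (GAt G - {F} \<Rightarrow>\<^sub>r F)"
| Ax_irr:
    "\<lbrakk>F \<in> VarsBot; F \<in> Sr G\<rbrakk> \<Longrightarrow> derivable G ({} \<^bold>; (GAt G - {F}) \<union> GImp G \<rightarrow>\<^sub>i F)"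
| And_reg:
    "\<lbrakk>derivable G (\<Gamma> \<Rightarrow>\<^sub>r A); A \<in> {A\<^sub>1, A\<^sub>2}; A\<^sub>1 \<^bold>\<and> A\<^sub>2 \<in> Sr G\<rbrakk>
     \<Longrightarrow> derivable G (\<Gamma> \<Rightarrow>\<^sub>r A\<^sub>1 \<^bold>\<and> A\<^sub>2)"
| And_irr:
    "\<lbrakk>derivable G (\<Sigma> \<^bold>; \<Theta> \<rightarrow>\<^sub>i A); A \<in> {A\<^sub>1, A\<^sub>2}; A\<^sub>1 \<^bold>\<and> A\<^sub>2 \<in> Sr G\<rbrakk>
     \<Longrightarrow> derivable G (\<Sigma> \<^bold>; \<Theta> \<rightarrow>\<^sub>i A\<^sub>1 \<^bold>\<and> A\<^sub>2)"
| Or_irr: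
    "\<lbrakk>derivable G (\<Sigma>\<^sub>1 \<^bold>; \<Theta>\<^sub>1 \<rightarrow>\<^sub>i C\<^sub>1); derivable G (\<Sigma>\<^sub>2 \<^bold>; \<Theta>\<^sub>2 \<rightarrow>\<^sub>i C\<^sub>2);
      \<Sigma>\<^sub>1 \<subseteq> \<Sigma>\<^sub>2 \<union> \<Theta>\<^sub>2; \<Sigma>\<^sub>2 \<subseteq> \<Sigma>\<^sub>1 \<union> \<Theta>\<^sub>1; C\<^sub>1 \<^bold>\<or> C\<^sub>2 \<in> Sr G\<rbrakk>
     \<Longrightarrow> derivable G (\<Sigma>\<^sub>1 \<union> \<Sigma>\<^sub>2 \<^bold>; \<Theta>\<^sub>1 \<inter> \<Theta>\<^sub>2 \<rightarrow>\<^sub>i C\<^sub>1 \<^bold>\<or> C\<^sub>2)"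
| Imp_in_reg:
    "\<lbrakk>derivable G (\<Gamma> \<Rightarrow>\<^sub>r B); A \<in> Cl \<Gamma>; A \<^bold>\<supset> B \<in> Sr G\<rbrakk>
     \<Longrightarrow> derivable G (\<Gamma> \<Rightarrow>\<^sub>r A \<^bold>\<supset> B)"
| Imp_in_irr:
    "\<lbrakk>derivable G (\<Sigma> \<^bold>; \<Theta> \<union> \<Lambda> \<rightarrow>\<^sub>i B); \<Theta> \<inter> \<Lambda> = {}; A \<in> Cl (\<Sigma> \<union> \<Lambda>);
      \<not> (\<exists>\<Lambda>'. \<Lambda>' \<subset> \<Lambda> \<and> A \<in> Cl (\<Sigma> \<union> \<Lambda>')); A \<^bold>\<supset> B \<in> Sr G\<rbrakk>
     \<Longrightarrow> derivable G (\<Sigma> \<union> \<Lambda> \<^bold>; \<Theta> \<rightarrow>\<^sub>i A \<^bold>\<supset> B)"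
| Imp_notin:
    "\<lbrakk>derivable G (\<Gamma> \<Rightarrow>\<^sub>r B); \<Theta> \<subseteq> Cl \<Gamma> \<inter> Gbar G; A \<in> Cl \<Gamma> - Cl \<Theta>;
      \<forall>\<Theta>'. \<Theta> \<subset> \<Theta>' \<and> \<Theta>' \<subseteq> Cl \<Gamma> \<inter> Gbar G \<longrightarrow> A \<in> Cl \<Theta>'; A \<^bold>\<supset> B \<in> Sr G\<rbrakk>
     \<Longrightarrow> derivable G ({} \<^bold>; \<Theta> \<rightarrow>\<^sub>i A \<^bold>\<supset> B)"
| Join_At:
    "\<lbrakk>n \<ge> 1; \<forall>j\<in>{1..n}. derivable G (S j \<^bold>; T j \<rightarrow>\<^sub>i A j); join_cond n S T A;
      F \<in> VarsBot - SigmaAt n S;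
      \<forall>Y\<in>Upsilon n A. \<exists>Z. Y \<^bold>\<supset> Z \<in> Sl G;
      F \<in> Sr G\<rbrakk>
     \<Longrightarrow> derivable G
          (SigmaAt n S \<union> (ThetaAt n T - {F}) \<union> SigmaImp n S \<union> ThetaImp n T A \<Rightarrow>\<^sub>r F)"
| Join_Or:
    "\<lbrakk>n \<ge> 1; \<forall>j\<in>{1..n}. derivable G (S j \<^bold>; T j \<rightarrow>\<^sub>i A j); join_cond n S T A;
      {C\<^sub>1, C\<^sub>2} \<subseteq> Upsilon n A;
      \<forall>Y\<in>Upsilon n A. \<exists>Z. Y \<^bold>\<supset> Z \<in> Sl G \<or> Y \<^bold>\<or> Z \<in> Sr G \<or> Z \<^bold>\<or> Y \<in> Sr G;
      C\<^sub>1 \<^bold>\<or> C\<^sub>2 \<in> Sr G\<rbrakk>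
     \<Longrightarrow> derivable G
          (SigmaAt n S \<union> ThetaAt n T \<union> SigmaImp n S \<union> ThetaImp n T A \<Rightarrow>\<^sub>r C\<^sub>1 \<^bold>\<or> C\<^sub>2)"

fun subsumed :: "sequent \<Rightarrow> sequent \<Rightarrow> bool"  (infix \<open>\<sqsubseteq>\<close> 50) where
  "(\<Gamma>\<^sub>1 \<Rightarrow>\<^sub>r C\<^sub>1) \<sqsubseteq> (\<Gamma>\<^sub>2 \<Rightarrow>\<^sub>r C\<^sub>2) \<longleftrightarrow> C\<^sub>1 = C\<^sub>2 \<and> \<Gamma>\<^sub>1 \<subseteq> \<Gamma>\<^sub>2"
| "(\<Sigma>\<^sub>1 \<^bold>; \<Theta>\<^sub>1 \<rightarrow>\<^sub>i C\<^sub>1) \<sqsubseteq> (\<Sigma>\<^sub>2 \<^bold>; \<Theta>\<^sub>2 \<rightarrow>\<^sub>i C\<^sub>2) \<longleftrightarrow> C\<^sub>1 = C\<^sub>2 \<and> \<Sigma>\<^sub>1 = \<Sigma>\<^sub>2 \<and> \<Theta>\<^sub>1 \<subseteq> \<Theta>\<^sub>2"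
| "_ \<sqsubseteq> _ \<longleftrightarrow> False"

definition strictly_subsumed :: "sequent \<Rightarrow> sequent \<Rightarrow> bool"  (infix \<open>\<sqsubset>\<close> 50) where
  "\<sigma>\<^sub>1 \<sqsubset> \<sigma>\<^sub>2 \<longleftrightarrow> \<sigma>\<^sub>1 \<sqsubseteq> \<sigma>\<^sub>2 \<and> \<sigma>\<^sub>1 \<noteq> \<sigma>\<^sub>2"

definition database :: "form \<Rightarrow> sequent set \<Rightarrow> bool" where
  "database G D \<longleftrightarrow> (\<forall>\<sigma>\<in>D. FRJ_sequent G \<sigma> \<and> derivable G \<sigma>)"

definition saturated :: "form \<Rightarrow> sequent set \<Rightarrow> bool" where
  "saturated G D \<longleftrightarrow>
     (\<forall>\<sigma>. FRJ_sequent G \<sigma> \<and> derivable G \<sigma> \<longrightarrow> (\<exists>\<sigma>'\<in>D. \<sigma> \<sqsubseteq> \<sigma>'))"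

definition compact_db :: "sequent set \<Rightarrow> bool" where
  "compact_db D \<longleftrightarrow> \<not> (\<exists>\<sigma>\<in>D. \<exists>\<sigma>'\<in>D. \<sigma>' \<sqsubset> \<sigma>)"

end

theory Submission
  imports Defs
begin

text \<open>Only finitely many sequents have their formulas among the subformulas of \<open>G\<close>, and
  subsumption is a partial order. So every derivable sequent lies below a maximal one, and the
  maximal derivable sequents form the required database: each of them is subsumed by itself only,
  hence belongs to every saturated database.\<close>

fun subformulas :: "form \<Rightarrow> form set" where
  "subformulas (Var p) = {Var p}"
| "subformulas Bot = {Bot}"
| "subformulas (A \<^bold>\<and> B) = insert (A \<^bold>\<and> B) (subformulas A \<union> subformulas B)"
| "subformulas (A \<^bold>\<or> B) = insert (A \<^bold>\<or> B) (subformulas A \<union> subformulas B)"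
| "subformulas (A \<^bold>\<supset> B) = insert (A \<^bold>\<supset> B) (subformulas A \<union> subformulas B)"

lemma finite_subformulas: "finite (subformulas G)"
  by (induction G) auto

lemma self_in_subformulas: "G \<in> subformulas G"
  by (cases G) auto

lemma subformulas_trans:
  "A \<in> subformulas G \<Longrightarrow> B \<in> subformulas A \<Longrightarrow> B \<in> subformulas G"
  by (induction G) auto

text \<open>The antecedent of an implication switches between the left and the right set, so the two
  claims need one simultaneous induction. Every rule except the root passes to an immediate
  subformula, and transitivity closes the case.\<close>

lemma Sl_Sr_subformulas:
  "A \<in> Sl G \<Longrightarrow> A \<in> subformulas G"
  "A \<in> Sr G \<Longrightarrow> A \<in> subformulas G"
proof (induction rule: Sl_Sr.inducts)
  case Sr_root
  show ?case by (rule self_in_subformulas)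
qed (erule subformulas_trans; simp add: self_in_subformulas)+

lemma finite_Gbar: "finite (Gbar G)"
  by (rule finite_subset[OF _ finite_subformulas])
    (auto simp: Gbar_def GAt_def GImp_def dest: Sl_Sr_subformulas)

lemma finite_Sr: "finite (Sr G)"
  by (rule finite_subset[OF _ finite_subformulas]) (auto dest: Sl_Sr_subformulas)

text \<open>A sequent is a tuple of one or two subsets of the finite set \<open>Gbar G\<close> and a
  right formula from the finite set \<open>Sr G\<close>.\<close>

lemma finite_FRJ_sequents: "finite {\<sigma>. FRJ_sequent G \<sigma>}"
proof (rule finite_subset)
  show "{\<sigma>. FRJ_sequent G \<sigma>} \<subseteq>
      (\<lambda>(\<Gamma>, C). \<Gamma> \<Rightarrow>\<^sub>r C) ` (Pow (Gbar G) \<times> Sr G) \<union>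
      (\<lambda>(\<Sigma>, \<Theta>, C). \<Sigma> \<^bold>; \<Theta> \<rightarrow>\<^sub>i C) ` (Pow (Gbar G) \<times> Pow (Gbar G) \<times> Sr G)"
  proof
    fix \<sigma> assume "\<sigma> \<in> {\<sigma>. FRJ_sequent G \<sigma>}"
    then show "\<sigma> \<in> (\<lambda>(\<Gamma>, C). \<Gamma> \<Rightarrow>\<^sub>r C) ` (Pow (Gbar G) \<times> Sr G) \<union>
      (\<lambda>(\<Sigma>, \<Theta>, C). \<Sigma> \<^bold>; \<Theta> \<rightarrow>\<^sub>i C) ` (Pow (Gbar G) \<times> Pow (Gbar G) \<times> Sr G)"
      by (cases \<sigma>) (auto simp: image_iff)
  qed
qed (simp add: finite_Gbar finite_Sr)

lemma subsumed_refl: "\<sigma> \<sqsubseteq> \<sigma>"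
  by (cases \<sigma>) auto

lemma subsumed_trans: "\<sigma> \<sqsubseteq> \<tau> \<Longrightarrow> \<tau> \<sqsubseteq> \<rho> \<Longrightarrow> \<sigma> \<sqsubseteq> \<rho>"
  by (cases \<sigma>; cases \<tau>; cases \<rho>) auto

lemma subsumed_antisym: "\<sigma> \<sqsubseteq> \<tau> \<Longrightarrow> \<tau> \<sqsubseteq> \<sigma> \<Longrightarrow> \<sigma> = \<tau>"
  by (cases \<sigma>; cases \<tau>) auto

definition maximal_sequents :: "sequent set \<Rightarrow> sequent set" where
  "maximal_sequents S = {\<sigma> \<in> S. \<forall>\<tau>\<in>S. \<sigma> \<sqsubseteq> \<tau> \<longrightarrow> \<tau> = \<sigma>}"

lemma subsumed_by_maximal:
  assumes "finite S" "\<sigma> \<in> S"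
  shows "\<exists>\<tau>\<in>maximal_sequents S. \<sigma> \<sqsubseteq> \<tau>"
proof -
  \<comment> \<open>By transitivity \<open>?U\<close> is closed upwards within \<open>S\<close>, so
    an element maximal in \<open>?U\<close> is maximal in all of \<open>S\<close>.\<close>
  let ?U = "{\<tau> \<in> S. \<sigma> \<sqsubseteq> \<tau>}"
  have "\<exists>\<tau>\<in>?U. \<forall>\<rho>\<in>?U. \<rho> \<noteq> \<tau> \<longrightarrow> \<not> \<tau> \<sqsubset> \<rho>"
  proof (rule Finite_Set.bex_max_element)
    show "finite ?U" "?U \<noteq> {}"
      using assms subsumed_refl by auto
    show "transp_on ?U (\<sqsubset>)" "asymp_on ?U (\<sqsubset>)"
      by (auto intro!: transp_onI asymp_onI simp: strictly_subsumed_def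
          dest: subsumed_trans subsumed_antisym)
  qed
  then show ?thesis
    unfolding maximal_sequents_def strictly_subsumed_def
    by (blast intro: subsumed_trans)
qed

text \<open>Finiteness enters through saturation, where a maximal sequent above a given one must
  exist. Compactness is immediate, since a maximal sequent is strictly subsumed by no other
  member.\<close>

lemma maximal_database:
  defines "S G \<equiv> {\<sigma>. FRJ_sequent G \<sigma> \<and> derivable G \<sigma>}"
  shows "database G (maximal_sequents (S G))"
    and "saturated G (maximal_sequents (S G))"
    and "compact_db (maximal_sequents (S G))"
proof -
  have "finite (S G)"
    unfolding S_def by (rule finite_subset[OF _ finite_FRJ_sequents[of G]]) auto
  then show "saturated G (maximal_sequents (S G))"
    using subsumed_by_maximal[of "S G"] by (simp add: saturated_def S_def)
qed (auto simp: database_def compact_db_def strictly_subsumed_def maximal_sequents_def S_def)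

text \<open>A sandwich argument: saturation of \<open>E\<close> and then of \<open>D\<close> leads
  from a member of \<open>D\<close> up into \<open>E\<close> and back into \<open>D\<close>.
  Compactness makes both ends equal, so antisymmetry identifies the middle sequent with
  them.\<close>

lemma compact_saturated_subset:
  assumes D: "database G D" "saturated G D" "compact_db D"
    and E: "database G E" "saturated G E"
  shows "D \<subseteq> E"
proof
  fix \<sigma> assume "\<sigma> \<in> D"
  with D(1) E(2) obtain \<tau> where \<tau>: "\<tau> \<in> E" "\<sigma> \<sqsubseteq> \<tau>"
    unfolding database_def saturated_def by blast
  with E(1) D(2) obtain \<rho> where \<rho>: "\<rho> \<in> D" "\<tau> \<sqsubseteq> \<rho>"
    unfolding database_def saturated_def by blast
  have "\<sigma> = \<rho>"
    using D(3) \<open>\<sigma> \<in> D\<close> \<rho>(1) subsumed_trans[OF \<tau>(2) \<rho>(2)]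
    unfolding compact_db_def strictly_subsumed_def by blast
  with \<tau> \<rho> show "\<sigma> \<in> E"
    using subsumed_antisym by blast
qed

theorem theorem4p4:
  fixes G :: form
  shows "(\<exists>!D. database G D \<and> saturated G D \<and> compact_db D) \<and>
    (\<forall>D. database G D \<and> saturated G D \<and> compact_db D \<longrightarrow>
      (\<forall>E. database G E \<and> saturated G E \<longrightarrow> D \<subseteq> E))"
  \<comment> \<open>Uniqueness applies the inclusion in both directions to two compact saturated
    databases; minimality is the inclusion itself.\<close>
  using maximal_database[of G] compact_saturated_subset[of G] by (metis subset_antisym)

end
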